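(* Let $A$ be a fixed zero-diagonal representative of an $\mathrm{SBIBD}(v,k,\lambda)$ and assume $k\ge\lambda+2$. Then $$q^*(A,2)=\begin{cases}\lambda+2,&\text{if }A\text{ contains a reciprocal pair},\\ \lambda+1,&\text{otherwise}.\end{cases}$$
   Context: Symmetric design. For integers $1\le\lambda<k<v$, an $\mathrm{SBIBD}(v,k,\lambda)$ consists of $v$ points and $v$ blocks such that every block contains $k$ points, every point lies in $k$ blocks, and every two distinct points lie together in exactly $\lambda$ blocks. After independently labeling points and blocks by $0,1,\dots,v-1$, the incidence matrix $A=(A_{ij})\in\{0,1\}^{v\times v}$, with $A_{ij}=1$ iff point $i$ lies in block $j$, is called a representative of the SBIBD. It is zero-diagonal if $A_{ii}=0$ for all $i$. Coding model. There are $v$ nodes $0,\dots,v-1$. For a node $i$ let $\mathcal S_{\mathrm{tgt}}(i)=\{j:A_{ij}=1\}$ (admissible targets) and $\mathcal S_{\mathrm{src}}(i)=\{h:A_{hi}=1\}$ (sources); both have size $k$. There is a finite collection of data objects, each a binary word of one common positive length; $\oplus$ is componentwise addition over $\mathbb F_2$. Each object $x$ has exactly one primary copy, stored at its primary node $i$, and for the replica count $q\in\{0,\dots,k\}$ it selects a set $T_x\subseteq\mathcal S_{\mathrm{tgt}}(i)$ of exactly $q$ distinct target nodes (chosen separately for each object) and sends one replica to each node in $T_x$. A placement is legal if at each node $j$ the replicas received at $j$ are partitioned into $k$-tuples, each containing exactly one replica from every primary node in $\mathcal S_{\mathrm{src}}(j)$ (the partition is part of the placement). For each such tuple, consisting of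 objects $x_1,\dots,x_k$, node $j$ stores one parity $x_1\oplus\cdots\oplus x_k$; the replicas are then discarded. Failures and recovery. Given a set $F$ of failed nodes, all primary copies and parities stored at nodes of $F$ are lost, and those stored at other nodes are alive. A placement permits recovery from $F$ if the values of all objects whose primary node is in $F$ are uniquely determined by the alive primary copies and the alive parities (the placement being known). Universal replica threshold. For an integer $p\ge1$, $q^*(A,p)$ is the smallest integer $q\in\{0,1,\dots,k\}$ such that every legal placement of any finite object collection using exactly $q$ target nodes per object permits recovery from every set of at most $p$ failed nodes. Reciprocal pair. Two distinct nodes $i,j$ form a reciprocal pair in $A$ if $j\in\mathcal S_{\mathrm{tgt}}(i)$ and $i\in\mathcal S_{\mathrm{tgt}}(j)$, i.e. $A_{ij}=A_{ji}=1$. *)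

theory Defs
  imports
    "HOL-Library.Z2"
    "HOL-Library.Disjoint_Sets"
    "Jordan_Normal_Form.Matrix"
begin

definition sbibd ::
  "'p set \<Rightarrow> 'b set \<Rightarrow> ('p \<Rightarrow> 'b \<Rightarrow> bool) \<Rightarrow> nat \<Rightarrow> nat \<Rightarrow> nat \<Rightarrow> bool" where
  "sbibd P B inc v k l \<longleftrightarrow>
     1 \<le> l \<and> l < k \<and> k < v \<and>
     finite P \<and> card P = v \<and> finite B \<and> card B = v \<and>
     (\<forall>b\<in>B. card {p \<in> P. inc p b} = k) \<and>
     (\<forall>p\<in>P. card {b \<in> B. inc p b} = k) \<and>
     (\<forall>p\<in>P. \<forall>p'\<in>P. p \<noteq> p' \<longrightarrow> card {b \<in> B. inc p b \<and> inc p' b} = l)"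

text \<open>Points and blocks are labelled independently, so a representative is an incidence
  matrix for some pair of labellings.\<close>

definition representative ::
  "nat mat \<Rightarrow> 'p set \<Rightarrow> 'b set \<Rightarrow> ('p \<Rightarrow> 'b \<Rightarrow> bool) \<Rightarrow> nat \<Rightarrow> bool" where
  "representative A P B inc v \<longleftrightarrow>
     (\<exists>pt bl. bij_betw pt {0..<v} P \<and> bij_betw bl {0..<v} B \<and>
        A = mat v v (\<lambda>(i, j). if inc (pt i) (bl j) then 1 else 0))"

definition zero_diagonal :: "nat mat \<Rightarrow> bool" where
  "zero_diagonal A \<longleftrightarrow> (\<forall>i < dim_row A. A $$ (i, i) = 0)"

definition nodes :: "nat mat \<Rightarrow> nat set" where
  "nodes A = {0..<dim_row A}"

definition targets :: "nat mat \<Rightarrow> nat \<Rightarrow> nat set" where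
  "targets A i = {j \<in> nodes A. A $$ (i, j) = 1}"

definition sources :: "nat mat \<Rightarrow> nat \<Rightarrow> nat set" where
  "sources A i = {h \<in> nodes A. A $$ (h, i) = 1}"

text \<open>The objects are the elements of a finite set \<open>X\<close> of natural numbers, which serve as
  names only. Object \<open>x\<close> has primary node \<open>prim x\<close> and target set \<open>T x\<close>. A replica received
  at \<open>j\<close> is identified with its object, since an object sends at most one replica to \<open>j\<close>;
  \<open>tuples j\<close> is the chosen partition of the replicas received at \<open>j\<close>.\<close>

definition received :: "nat set \<Rightarrow> (nat \<Rightarrow> nat set) \<Rightarrow> nat \<Rightarrow> nat set" where
  "received X T j = {x \<in> X. j \<in> T x}"

definition legal_placement ::
  "nat mat \<Rightarrow> nat \<Rightarrow> nat \<Rightarrow> nat set \<Rightarrow> (nat \<Rightarrow> nat) \<Rightarrow> (nat \<Rightarrow> nat set) \<Rightarrow>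
   (nat \<Rightarrow> nat set set) \<Rightarrow> bool" where
  "legal_placement A k q X prim T tuples \<longleftrightarrow>
     (\<forall>x\<in>X. prim x \<in> nodes A \<and> T x \<subseteq> targets A (prim x) \<and> card (T x) = q) \<and>
     (\<forall>j\<in>nodes A. partition_on (received X T j) (tuples j) \<and>
        (\<forall>t\<in>tuples j. card t = k \<and> (\<forall>h\<in>sources A j. \<exists>!x. x \<in> t \<and> prim x = h)))"

definition parity :: "nat \<Rightarrow> (nat \<Rightarrow> bit vec) \<Rightarrow> nat set \<Rightarrow> bit vec" where
  "parity n w t = finsum_vec TYPE(bit) n w t"

text \<open>The words have length \<open>n\<close>. Unique determination: two assignments of words to the objects
  that agree on everything alive agree on the objects whose primary node failed.\<close>

definition permits_recovery ::
  "nat mat \<Rightarrow> nat \<Rightarrow> nat set \<Rightarrow> (nat \<Rightarrow> nat) \<Rightarrow> (nat \<Rightarrow> nat set set) \<Rightarrow> nat set \<Rightarrow> bool" where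
  "permits_recovery A n X prim tuples F \<longleftrightarrow>
     (\<forall>w w'. w \<in> X \<rightarrow> carrier_vec n \<longrightarrow> w' \<in> X \<rightarrow> carrier_vec n \<longrightarrow>
        (\<forall>x\<in>X. prim x \<notin> F \<longrightarrow> w x = w' x) \<longrightarrow>
        (\<forall>j \<in> nodes A - F. \<forall>t \<in> tuples j. parity n w t = parity n w' t) \<longrightarrow>
        (\<forall>x\<in>X. prim x \<in> F \<longrightarrow> w x = w' x))"

definition universally_recoverable :: "nat mat \<Rightarrow> nat \<Rightarrow> nat \<Rightarrow> nat \<Rightarrow> bool" where
  "universally_recoverable A k p q \<longleftrightarrow>
     (\<forall>X prim T tuples n F.
        finite X \<longrightarrow> 1 \<le> n \<longrightarrow> legal_placement A k q X prim T tuples \<longrightarrow>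
        F \<subseteq> nodes A \<longrightarrow> card F \<le> p \<longrightarrow> permits_recovery A n X prim tuples F)"

text \<open>\<open>k\<close> is the common size of the target and source sets of \<open>A\<close>. If no admissible \<open>q\<close> exists,
  this \<open>LEAST\<close> is an unspecified number, about which no concrete value can be proved.\<close>

definition replica_threshold :: "nat mat \<Rightarrow> nat \<Rightarrow> nat \<Rightarrow> nat" where
  "replica_threshold A k p = (LEAST q. q \<in> {0..k} \<and> universally_recoverable A k p q)"

definition reciprocal_pair :: "nat mat \<Rightarrow> nat \<Rightarrow> nat \<Rightarrow> bool" where
  "reciprocal_pair A i j \<longleftrightarrow>
     i \<in> nodes A \<and> j \<in> nodes A \<and> i \<noteq> j \<and> j \<in> targets A i \<and> i \<in> targets A j"

end

theory Submission
  imports Defs "HOL-Library.Nat_Bijection" "HOL-Combinatorics.Transposition"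
begin

text \<open>
  Let \<open>a \<noteq> b\<close> be the failed nodes. A replica of an object \<open>x\<close> of \<open>a\<close> at an alive node outside
  the targets of \<open>b\<close> lies in a parity in which \<open>x\<close> is the only lost object. Hence \<open>x\<close> resists
  direct decoding only if all its targets are among the \<open>l\<close> common targets of \<open>a\<close> and \<open>b\<close> and
  the node \<open>b\<close>; \<open>l + 2\<close> replicas always suffice. With \<open>l + 1\<close> replicas, this obstruction
  for the objects of \<open>a\<close> needs \<open>b\<close> to be a target of \<open>a\<close>, so if \<open>(a, b)\<close> is not reciprocal one
  of the nodes is decoded directly, and then the other one through a common target.

  Conversely, let every node own one object for each \<open>q\<close>-subset of its targets. Two objects of
  \<open>a\<close> and \<open>b\<close> whose target sets agree up to \<open>a\<close> and \<open>b\<close> can be put into the same tuple at each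
  alive node, and changing both by the same word is then invisible.
\<close>

section \<open>Partitions into transversals, and subset counts\<close>

text \<open>Composing any enumeration with a transposition moves \<open>s\<close> to index 0. Giving
  index 0 to the distinguished element of every fibre later puts all of them in one class.\<close>

lemma bij_betw_lessThan_with_zero:
  assumes "finite G" "card G = N"
  obtains h where "bij_betw h G {..<N}" "s \<in> G \<Longrightarrow> h s = (0::nat)"
proof -
  obtain g where g: "bij_betw g G {..<N}"
    using ex_bij_betw_finite_nat[OF assms(1)] assms(2) by (auto simp: atLeast0LessThan)
  show thesis
  proof (cases "s \<in> G")
    case True
    have gs: "g s < N" using bij_betwE[OF g] True by auto
    have "bij_betw (transpose (g s) 0) {..<N} {..<N}"
      using gs by (auto simp: bij_betw_transpose_iff)
    from bij_betw_trans[OF g this] show thesis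
      by (intro that[of "transpose (g s) 0 \<circ> g"]) auto
  next
    case False
    with g show thesis using that by blast
  qed
qed

text \<open>Number every fibre of \<open>prim\<close> by \<open>0..N-1\<close>, with its element of
  \<open>Z\<close>, if any, getting 0. Elements with equal numbers form one transversal, and all of
  \<open>Z\<close> falls into the class of 0.\<close>

lemma transversal_partition:
  fixes prim :: "'a \<Rightarrow> 'b"
  assumes H: "finite H" "H \<noteq> {}"
    and R: "\<And>x. x \<in> R \<Longrightarrow> prim x \<in> H"
    and fin: "finite R"
    and fibre: "\<And>h. h \<in> H \<Longrightarrow> card {x \<in> R. prim x = h} = N"
    and Z: "Z \<subseteq> R" "inj_on prim Z"
  shows "\<exists>Q. partition_on R Q \<and>
    (\<forall>t\<in>Q. card t = card H \<and> (\<forall>h\<in>H. \<exists>!x. x \<in> t \<and> prim x = h) \<and>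
      (t \<inter> Z = {} \<or> Z \<subseteq> t))"
proof -
  define G where "G h = {x \<in> R. prim x = h}" for h
  \<comment> \<open>An arbitrary value when \<open>Z\<close> does not meet the fibre of
    \<open>h\<close>; if that value happens to lie in \<open>G h\<close>, its getting number 0 does
    no harm.\<close>
  define s where "s h = (SOME z. z \<in> Z \<and> prim z = h)" for h
  have s: "s (prim z) = z" if "z \<in> Z" for z
  proof -
    have "s (prim z) \<in> Z \<and> prim (s (prim z)) = prim z"
      unfolding s_def by (rule someI[of _ z]) (use that in simp)
    thus ?thesis using Z(2) that by (auto dest: inj_onD)
  qed
  have "\<exists>f. bij_betw f (G h) {..<N} \<and> (s h \<in> G h \<longrightarrow> f (s h) = 0)" if "h \<in> H" for h
  proof -
    have "finite (G h)" "card (G h) = N" using fin fibre[OF that] by (auto simp: G_def)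
    thus ?thesis by (rule bij_betw_lessThan_with_zero) blast
  qed
  then obtain f where f: "\<And>h. h \<in> H \<Longrightarrow> bij_betw (f h) (G h) {..<N}"
    "\<And>h. h \<in> H \<Longrightarrow> s h \<in> G h \<Longrightarrow> f h (s h) = 0"
    by metis
  define c where "c x = f (prim x) x" for x
  define tup where "tup m = {x \<in> R. c x = m}" for m
  have ex1: "\<exists>!x. x \<in> tup m \<and> prim x = h" if "m < N" "h \<in> H" for m h
  proof -
    have "\<exists>!x. x \<in> G h \<and> f h x = m"
    proof -
      have "m \<in> f h ` G h" "inj_on (f h) (G h)"
        using f(1)[OF that(2)] that(1) by (simp_all add: bij_betw_def)
      thus ?thesis by (auto simp: inj_on_def)
    qed
    moreover have "x \<in> tup m \<and> prim x = h \<longleftrightarrow> x \<in> G h \<and> f h x = m" for x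
      by (auto simp: tup_def G_def c_def)
    ultimately show ?thesis by simp
  qed
  have cN: "c x < N" if "x \<in> R" for x
    using bij_betwE[OF f(1)[OF R[OF that]]] that by (auto simp: c_def G_def)
  have card: "card (tup m) = card H" if "m < N" for m
  proof (rule bij_betw_same_card[of prim], rule bij_betw_imageI)
    show "inj_on prim (tup m)"
      using ex1[OF that] R by (fastforce simp: inj_on_def tup_def)
    show "prim ` tup m = H"
    proof
      show "prim ` tup m \<subseteq> H" using R by (auto simp: tup_def)
      show "H \<subseteq> prim ` tup m" using ex1[OF that] by blast
    qed
  qed
  have c0: "c z = 0" if "z \<in> Z" for z
    using f(2)[of "prim z"] s[OF that] that Z(1) R by (auto simp: G_def c_def)
  show ?thesis
  proof (intro exI[of _ "tup ` {..<N}"] conjI ballI)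
    show "partition_on R (tup ` {..<N})"
    proof (rule partition_onI)
      show "\<Union> (tup ` {..<N}) = R" using cN by (auto simp: tup_def)
      have "tup m \<noteq> {}" if "m < N" for m
        using card[OF that] H by (metis card.empty card_0_eq)
      thus "{} \<notin> tup ` {..<N}" by auto
      show "disjnt p p'" if "p \<in> tup ` {..<N}" "p' \<in> tup ` {..<N}" "p \<noteq> p'" for p p'
        using that by (auto simp: tup_def disjnt_def)
    qed
  next
    fix t assume "t \<in> tup ` {..<N}"
    then obtain m where m: "m < N" "t = tup m" by auto
    show "card t = card H" using card m by simp
    show "\<exists>!x. x \<in> t \<and> prim x = h" if "h \<in> H" for h
      using ex1 m that by simp
    show "t \<inter> Z = {} \<or> Z \<subseteq> t"
      using c0 Z(1) m by (cases "m = 0") (auto simp: tup_def)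
  qed
qed

text \<open>The count depends on \<open>S\<close> only through its size, so in the complete family
  of objects all sources of a node send it equally many replicas.\<close>

lemma card_subsets_containing:
  assumes "finite S" "j \<in> S" "0 < q"
  shows "card {U. U \<subseteq> S \<and> card U = q \<and> j \<in> U} = (card S - 1) choose (q - 1)"
proof -
  have "bij_betw (insert j) {U. U \<subseteq> S - {j} \<and> card U = q - 1}
      {U. U \<subseteq> S \<and> card U = q \<and> j \<in> U}"
  proof (rule bij_betwI[where g = "\<lambda>U. U - {j}"])
    show "insert j \<in> {U. U \<subseteq> S - {j} \<and> card U = q - 1} \<rightarrow> {U. U \<subseteq> S \<and> card U = q \<and> j \<in> U}"
    proof
      fix U assume U: "U \<in> {U. U \<subseteq> S - {j} \<and> card U = q - 1}"
      moreover from U have "finite U" "j \<notin> U"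
        using assms(1) by (auto intro: finite_subset)
      ultimately show "insert j U \<in> {U. U \<subseteq> S \<and> card U = q \<and> j \<in> U}"
        using assms by auto
    qed
    show "(\<lambda>U. U - {j}) \<in> {U. U \<subseteq> S \<and> card U = q \<and> j \<in> U} \<rightarrow> {U. U \<subseteq> S - {j} \<and> card U = q - 1}"
      by auto
  qed auto
  from bij_betw_same_card[OF this] show ?thesis
    using assms n_subsets[of "S - {j}" "q - 1"] by simp
qed

section \<open>Parities over the two-element field\<close>

lemma parity_index:
  assumes "finite t" "w \<in> t \<rightarrow> carrier_vec n" "i < n"
  shows "parity n w t $ i = (\<Sum>x\<in>t. w x $ i)"
  using assms by (simp add: parity_def index_finsum_vec)

text \<open>Decoding a single unknown: coordinatewise, the contributions of all other members are
  equal and cancel.\<close>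

lemma parity_cancel:
  assumes t: "finite t" "x \<in> t"
    and w: "w \<in> t \<rightarrow> carrier_vec n" "w' \<in> t \<rightarrow> carrier_vec n"
    and eq: "\<And>y. y \<in> t \<Longrightarrow> y \<noteq> x \<Longrightarrow> w y = w' y"
    and par: "parity n w t = parity n w' t"
  shows "w x = w' x"
proof (rule eq_vecI)
  have dims: "dim_vec (w x) = n" "dim_vec (w' x) = n"
    using w t(2) by (auto simp: Pi_iff)
  show "dim_vec (w x) = dim_vec (w' x)" using dims by simp
  fix i assume "i < dim_vec (w' x)"
  hence i: "i < n" using dims by simp
  have "(\<Sum>y\<in>t. w y $ i) = (\<Sum>y\<in>t. w' y $ i)"
    using par parity_index[OF t(1) w(1) i] parity_index[OF t(1) w(2) i] by simp
  moreover have "(\<Sum>y\<in>t - {x}. w y $ i) = (\<Sum>y\<in>t - {x}. w' y $ i)"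
    using eq by (intro sum.cong) auto
  ultimately show "w x $ i = w' x $ i"
    by (simp only: sum.remove[OF t] add_right_cancel)
qed

text \<open>A tuple holding both objects gains \<open>1 + 1 = 0\<close> in every coordinate; a tuple
  holding neither is unaffected.\<close>

lemma parity_flip_pair:
  assumes "finite t" "xa \<noteq> xb" "xa \<in> t \<longleftrightarrow> xb \<in> t"
  shows "parity n (\<lambda>x. if x = xa \<or> x = xb then vec n (\<lambda>_. 1) else 0\<^sub>v n) t
       = parity n (\<lambda>_. 0\<^sub>v n) t" (is "parity n ?w t = parity n ?z t")
proof (rule eq_vecI)
  have w: "?w \<in> t \<rightarrow> carrier_vec n" "?z \<in> t \<rightarrow> carrier_vec n" by auto
  have dims: "parity n ?w t \<in> carrier_vec n" "parity n ?z t \<in> carrier_vec n"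
    unfolding parity_def using w by (intro finsum_vec_closed; simp)+
  show "dim_vec (parity n ?w t) = dim_vec (parity n ?z t)" using dims by auto
  fix i assume "i < dim_vec (parity n ?z t)"
  hence i: "i < n" using dims by auto
  have "(\<Sum>x\<in>t. ?w x $ i) = (\<Sum>x\<in>t. if x \<in> {xa, xb} then 1 else 0)"
    using i by (intro sum.cong) auto
  also have "\<dots> = (\<Sum>x\<in>t \<inter> {xa, xb}. 1)"
    by (rule sum.inter_restrict[OF assms(1), symmetric])
  also have "\<dots> = 0"
  proof (cases "xa \<in> t")
    case True
    hence "t \<inter> {xa, xb} = {xa, xb}" using assms by auto
    thus ?thesis using assms(2) by simp
  next
    case False
    hence "t \<inter> {xa, xb} = {}" using assms by auto
    thus ?thesis by simp
  qed
  also have "\<dots> = (\<Sum>x\<in>t. ?z x $ i)" using i by simp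
  finally show "parity n ?w t $ i = parity n ?z t $ i"
    unfolding parity_index[OF assms(1) w(1) i] parity_index[OF assms(1) w(2) i] .
qed

text \<open>A smaller failure set leaves more data alive. This reduces the upper bound to exactly
  two failed nodes.\<close>

lemma permits_recovery_mono:
  assumes "permits_recovery A n X prim tuples F'" "F \<subseteq> F'"
  shows "permits_recovery A n X prim tuples F"
  unfolding permits_recovery_def
proof (intro allI impI)
  fix w w'
  assume w: "w \<in> X \<rightarrow> carrier_vec n" "w' \<in> X \<rightarrow> carrier_vec n"
    and alive: "\<forall>x\<in>X. prim x \<notin> F \<longrightarrow> w x = w' x"
    and par: "\<forall>j\<in>nodes A - F. \<forall>t\<in>tuples j. parity n w t = parity n w' t"
  have "\<forall>x\<in>X. prim x \<notin> F' \<longrightarrow> w x = w' x"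
    "\<forall>j\<in>nodes A - F'. \<forall>t\<in>tuples j. parity n w t = parity n w' t"
    using alive par assms(2) by blast+
  hence "\<forall>x\<in>X. prim x \<in> F' \<longrightarrow> w x = w' x"
    using assms(1) w by (simp add: permits_recovery_def)
  thus "\<forall>x\<in>X. prim x \<in> F \<longrightarrow> w x = w' x" using assms(2) by blast
qed

section \<open>Counting properties of the representative\<close>

text \<open>The design enters only through these counts on rows and columns, which are free of the
  labellings.\<close>

locale zero_diagonal_design =
  fixes A :: "nat mat" and k l :: nat
  assumes diag: "zero_diagonal A"
    and card_targets: "\<And>i. i \<in> nodes A \<Longrightarrow> card (targets A i) = k"
    and card_sources: "\<And>i. i \<in> nodes A \<Longrightarrow> card (sources A i) = k"
    and card_common: "\<And>i j. i \<in> nodes A \<Longrightarrow> j \<in> nodes A \<Longrightarrow> i \<noteq> j \<Longrightarrow>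
      card (targets A i \<inter> targets A j) = l"
    and l_pos: "0 < l"
    and k_ge: "l + 2 \<le> k"
    and k_less: "k < card (nodes A)"
begin

lemma finite_nodes [simp]: "finite (nodes A)"
  by (simp add: nodes_def)

lemma targets_nodes: "targets A i \<subseteq> nodes A"
  by (auto simp: targets_def)

lemma finite_targets [simp]: "finite (targets A i)"
  using finite_subset[OF targets_nodes] by simp

lemma not_self_target: "i \<notin> targets A i"
  using diag by (auto simp: targets_def nodes_def zero_diagonal_def)

lemma sources_iff: "i \<in> nodes A \<Longrightarrow> j \<in> nodes A \<Longrightarrow> i \<in> sources A j \<longleftrightarrow> j \<in> targets A i"
  by (simp add: sources_def targets_def)

lemma finite_sources [simp]: "finite (sources A i)"
  by (simp add: sources_def)

section \<open>Upper bound: decoding after two failures\<close>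

text \<open>The tuple of \<open>x\<close> at \<open>j\<close> has only one object with primary node
  \<open>prim x\<close>. All its other members thus come from other sources of \<open>j\<close> and
  are known by \<open>others\<close>, so \<open>x\<close> is the only unknown.\<close>

lemma object_determined:
  assumes leg: "legal_placement A k q X prim T tuples"
    and w: "w \<in> X \<rightarrow> carrier_vec n" "w' \<in> X \<rightarrow> carrier_vec n"
    and par: "\<And>t. t \<in> tuples j \<Longrightarrow> parity n w t = parity n w' t"
    and x: "x \<in> X" "j \<in> T x"
    and others: "\<And>y. y \<in> X \<Longrightarrow> j \<in> targets A (prim y) \<Longrightarrow> prim y \<noteq> prim x \<Longrightarrow> w y = w' y"
  shows "w x = w' x"
proof -
  have obj: "prim y \<in> nodes A" "T y \<subseteq> targets A (prim y)" if "y \<in> X" for y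
    using leg that by (auto simp: legal_placement_def)
  have j: "j \<in> nodes A" using obj(2)[OF x(1)] x targets_nodes by auto
  have part: "partition_on (received X T j) (tuples j)"
    and tup: "\<And>t. t \<in> tuples j \<Longrightarrow> card t = k \<and> (\<forall>h\<in>sources A j. \<exists>!x. x \<in> t \<and> prim x = h)"
    using leg j by (auto simp: legal_placement_def)
  obtain t where t: "t \<in> tuples j" "x \<in> t"
    using partition_onD1[OF part] x by (auto simp: received_def)
  have tX: "y \<in> X \<and> j \<in> T y" if "y \<in> t" for y
    using partition_onD1[OF part] t that by (auto simp: received_def)
  show ?thesis
  proof (rule parity_cancel[OF _ t(2) _ _ _ par[OF t(1)]])
    \<comment> \<open>Infinite sets have \<open>card\<close> 0, so cardinality \<open>k > 0\<close>
      forces finiteness.\<close>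
    show "finite t" using tup[OF t(1)] k_ge by (intro card_ge_0_finite) auto
    show "w \<in> t \<rightarrow> carrier_vec n" "w' \<in> t \<rightarrow> carrier_vec n" using w tX by auto
    fix y assume y: "y \<in> t" "y \<noteq> x"
    have "prim x \<in> sources A j"
      using sources_iff[OF obj(1)[OF x(1)] j] obj(2)[OF x(1)] x(2) by auto
    hence "prim y \<noteq> prim x" using tup[OF t(1)] t(2) y by blast
    thus "w y = w' y" using others[of y] tX[OF y(1)] obj(2)[of y] by auto
  qed
qed

text \<open>The two nodes are treated in order. Objects of \<open>b\<close> have too many targets to
  fit into the common targets and \<open>a\<close>, so they are decoded directly; afterwards an
  object of \<open>a\<close> needs just one replica at an alive node.\<close>

lemma permits_recovery_pair:
  assumes leg: "legal_placement A k q X prim T tuples"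
    and ab: "a \<in> nodes A" "b \<in> nodes A" "a \<noteq> b"
    and q: "q = l + 2 \<or> q = l + 1 \<and> a \<notin> targets A b"
  shows "permits_recovery A n X prim tuples {a, b}"
  unfolding permits_recovery_def
proof (intro allI impI)
  fix w w'
  assume w: "w \<in> X \<rightarrow> carrier_vec n" "w' \<in> X \<rightarrow> carrier_vec n"
    and alive: "\<forall>x\<in>X. prim x \<notin> {a, b} \<longrightarrow> w x = w' x"
    and par: "\<forall>j\<in>nodes A - {a, b}. \<forall>t\<in>tuples j. parity n w t = parity n w' t"
  let ?C = "targets A a \<inter> targets A b"
  have cardC: "card ?C = l" using card_common ab by blast
  have obj: "T y \<subseteq> targets A (prim y)" "card (T y) = q" if "y \<in> X" for y
    using leg that by (auto simp: legal_placement_def)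
  have determined: "w x = w' x"
    if x: "x \<in> X" "j \<in> T x" "j \<noteq> a" "j \<noteq> b"
      and others: "\<And>y. y \<in> X \<Longrightarrow> prim y \<in> {a, b} \<Longrightarrow> j \<in> targets A (prim y) \<Longrightarrow>
        prim y \<noteq> prim x \<Longrightarrow> w y = w' y" for x j
    using par targets_nodes obj(1)[OF x(1)] x alive others
    by (intro object_determined[OF leg w _ x(1,2)]) blast+
  \<comment> \<open>Outside the common targets, \<open>j\<close> receives nothing from the other
    failed node, so the premise on other lost objects is vacuous.\<close>
  have exclusive: "w x = w' x"
    if x: "x \<in> X" "prim x \<in> {a, b}" and j: "j \<in> T x" "j \<notin> insert a (insert b ?C)" for x j
    using x j obj(1)[OF x(1)] by (intro determined[OF x(1) j(1)]) auto
  have escape: "\<exists>j\<in>T x. j \<notin> D" if "x \<in> X" "card D < q" "finite D" for x D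
    using card_mono[OF that(3), of "T x"] obj(2)[OF that(1)] that(2) by force
  have B: "w x = w' x" if x: "x \<in> X" "prim x = b" for x
  proof -
    have nb: "b \<notin> T x" using obj(1)[OF x(1)] x not_self_target by auto
    have "\<exists>j\<in>T x. j \<notin> insert a ?C"
      using q
    proof
      assume "q = l + 2"
      thus ?thesis
        using cardC by (intro escape[OF x(1)]) (auto simp: card_insert_if)
    next
      assume h: "q = l + 1 \<and> a \<notin> targets A b"
      hence "a \<notin> T x" using obj(1)[OF x(1)] x by auto
      moreover have "\<exists>j\<in>T x. j \<notin> ?C" using cardC h by (intro escape[OF x(1)]) auto
      ultimately show ?thesis by auto
    qed
    then obtain j where "j \<in> T x" "j \<notin> insert a (insert b ?C)" using nb by auto
    thus ?thesis using exclusive x by blast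
  qed
  have A: "w x = w' x" if x: "x \<in> X" "prim x = a" for x
  proof -
    have na: "a \<notin> T x" using obj(1)[OF x(1)] x not_self_target by auto
    \<comment> \<open>Here \<open>l > 0\<close> matters: it gives \<open>q \<ge> 2\<close>, hence a
      target other than \<open>b\<close>.\<close>
    obtain j where j: "j \<in> T x" "j \<notin> {b}"
      using escape[OF x(1), of "{b}"] q l_pos by auto
    show ?thesis
      using j na x B by (intro determined[OF x(1) j(1)]) auto
  qed
  show "\<forall>x\<in>X. prim x \<in> {a, b} \<longrightarrow> w x = w' x" using A B by blast
qed

lemma universally_recoverable_upper:
  assumes "q = l + 2 \<or> q = l + 1 \<and> (\<nexists>i j. reciprocal_pair A i j)"
  shows "universally_recoverable A k 2 q"
  unfolding universally_recoverable_def
proof (intro allI impI)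
  fix X :: "nat set" and prim T tuples n F
  assume leg: "legal_placement A k q X prim T tuples"
    and F: "F \<subseteq> nodes A" "card F \<le> 2"
  obtain F' where F': "F \<subseteq> F'" "F' \<subseteq> nodes A" "card F' = 2"
    using exists_subset_between[OF F(2) _ F(1)] k_ge k_less by auto
  then obtain a b where ab: "F' = {a, b}" "a \<noteq> b" by (auto simp: card_2_iff)
  \<comment> \<open>A non-reciprocal pair misses at least one direction; the missing one decides
    which node is decoded first.\<close>
  have "q = l + 2 \<or> q = l + 1 \<and> a \<notin> targets A b \<or> q = l + 1 \<and> b \<notin> targets A a"
    using assms ab F' by (auto simp: reciprocal_pair_def)
  hence "permits_recovery A n X prim tuples F'"
    using permits_recovery_pair[OF leg, of a b n] permits_recovery_pair[OF leg, of b a n]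
      ab F'(2) by (auto simp: insert_commute)
  thus "permits_recovery A n X prim tuples F"
    using permits_recovery_mono F'(1) by blast
qed

section \<open>Lower bound: indistinguishable assignments\<close>

text \<open>The last assumption says that both target sets meet the alive nodes equally. The
  complete family of objects makes the placement legal, since every source then sends a node the
  same number of replicas.\<close>

lemma not_universally_recoverable_pair:
  assumes ab: "a \<in> nodes A" "b \<in> nodes A" "a \<noteq> b"
    and S: "Sa \<subseteq> targets A a" "Sb \<subseteq> targets A b" "card Sa = q" "card Sb = q"
      "Sa - {a, b} = Sb - {a, b}"
  shows "\<not> universally_recoverable A k 2 q"
proof
  assume univ: "universally_recoverable A k 2 q"
  \<comment> \<open>Objects are named by natural numbers, so primary node and target set are packed
    into one number; decoding the set is faithful for finite sets.\<close>
  define code :: "nat \<Rightarrow> nat set \<Rightarrow> nat" where "code i S = prod_encode (i, set_encode S)" for i S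
  define prim :: "nat \<Rightarrow> nat" where "prim x = fst (prod_decode x)" for x
  define T :: "nat \<Rightarrow> nat set" where "T x = set_decode (snd (prod_decode x))" for x
  define X where "X = {x. prim x \<in> nodes A \<and> T x \<subseteq> targets A (prim x) \<and> card (T x) = q}"
  have prim_code [simp]: "prim (code i S) = i" for i S
    by (simp add: prim_def code_def)
  have T_code [simp]: "T (code i S) = S" if "finite S" for i S
    using that by (simp add: T_def code_def)
  have code_T [simp]: "code (prim x) (T x) = x" for x
    by (simp add: code_def prim_def T_def)
  have finX: "finite X"
  proof (rule finite_subset)
    show "X \<subseteq> (\<lambda>(i, S). code i S) ` (nodes A \<times> Pow (nodes A))"
    proof
      fix x assume "x \<in> X"
      thus "x \<in> (\<lambda>(i, S). code i S) ` (nodes A \<times> Pow (nodes A))"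
        using targets_nodes by (intro image_eqI[of _ _ "(prim x, T x)"]) (auto simp: X_def)
    qed
  qed simp
  have finS [simp]: "finite Sa" "finite Sb"
    using S(1,2) by (auto intro: finite_subset[OF _ finite_targets])
  define xa where "xa = code a Sa"
  define xb where "xb = code b Sb"
  have special: "xa \<in> X" "xb \<in> X" "prim xa = a" "prim xb = b" "xa \<noteq> xb" "T xa = Sa" "T xb = Sb"
  proof -
    show "xa \<in> X" "xb \<in> X" "prim xa = a" "prim xb = b" "T xa = Sa" "T xb = Sb"
      using ab S by (auto simp: X_def xa_def xb_def)
    thus "xa \<noteq> xb" using ab(3) by auto
  qed
  \<comment> \<open>Intersecting with the received replicas matters at \<open>a\<close> and
    \<open>b\<close>, where possibly only one of \<open>xa\<close> and \<open>xb\<close>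
    arrives.\<close>
  define good where "good j Q \<longleftrightarrow> partition_on (received X T j) Q \<and>
      (\<forall>t\<in>Q. card t = k \<and> (\<forall>h\<in>sources A j. \<exists>!x. x \<in> t \<and> prim x = h) \<and>
        (t \<inter> ({xa, xb} \<inter> received X T j) = {} \<or> {xa, xb} \<inter> received X T j \<subseteq> t))" for j Q
  have "\<exists>Q. good j Q"
    if j: "j \<in> nodes A" for j
  proof -
    \<comment> \<open>Truncated subtraction would make the binomial 1 at \<open>q = 0\<close>,
      although no replica is sent then.\<close>
    define N where "N = (if q = 0 then 0 else (k - 1) choose (q - 1))"
    have fibre: "card {x \<in> received X T j. prim x = h} = N" if h: "h \<in> sources A j" for h
    proof -
      have hn: "h \<in> nodes A" using h by (simp add: sources_def)
      have jh: "j \<in> targets A h" using sources_iff[OF hn j] h by simp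
      let ?V = "{U. U \<subseteq> targets A h \<and> card U = q \<and> j \<in> U}"
      have fin: "finite U" if "U \<in> ?V" for U using that by (auto intro: finite_subset)
      have "bij_betw (code h) ?V {x \<in> received X T j. prim x = h}"
      proof (rule bij_betwI[where g = T])
        show "code h \<in> ?V \<rightarrow> {x \<in> received X T j. prim x = h}"
          using hn fin by (auto simp: received_def X_def)
        show "T \<in> {x \<in> received X T j. prim x = h} \<rightarrow> ?V"
          by (auto simp: received_def X_def)
        show "T (code h U) = U" if "U \<in> ?V" for U
          using fin[OF that] by simp
        show "code h (T x) = x" if "x \<in> {x \<in> received X T j. prim x = h}" for x
          using that code_T[of x] by auto
      qed
      moreover have "card ?V = N"
      proof (cases "q = 0")
        case True
        have "U \<notin> ?V" for U
        proof
          assume U: "U \<in> ?V"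
          hence "card U = 0" "j \<in> U" using True by simp_all
          thus False using card_0_eq[OF fin[OF U]] by blast
        qed
        hence "?V = {}" by blast
        hence "card ?V = 0" by (simp only: card.empty)
        also have "0 = N" using True by (simp add: N_def)
        finally show ?thesis .
      next
        case False
        thus ?thesis
          using card_subsets_containing[OF finite_targets jh, of q] card_targets[OF hn]
          by (simp add: N_def)
      qed
      ultimately show ?thesis using bij_betw_same_card by fastforce
    qed
    have ne: "sources A j \<noteq> {}" using card_sources[OF j] k_ge by auto
    have R: "prim x \<in> sources A j" if "x \<in> received X T j" for x
      using that sources_iff[of "prim x" j] j by (auto simp: received_def X_def)
    have fR: "finite (received X T j)" using finX by (simp add: received_def)
    have inj: "inj_on prim ({xa, xb} \<inter> received X T j)"
      using special ab(3) by (auto simp: inj_on_def)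
    show ?thesis
      using transversal_partition[OF finite_sources ne R fR fibre Int_lower2 inj]
      unfolding card_sources[OF j] good_def .
  qed
  then obtain tuples where tuples: "good j (tuples j)" if "j \<in> nodes A" for j
    by metis
  have part: "partition_on (received X T j) (tuples j)" if "j \<in> nodes A" for j
    using tuples[OF that] by (simp add: good_def)
  have tup: "card t = k" "\<forall>h\<in>sources A j. \<exists>!x. x \<in> t \<and> prim x = h"
    and together: "t \<inter> ({xa, xb} \<inter> received X T j) = {} \<or> {xa, xb} \<inter> received X T j \<subseteq> t"
    if "j \<in> nodes A" "t \<in> tuples j" for j t
    using bspec[OF conjunct2[OF tuples[OF that(1), unfolded good_def]] that(2)]
    by - (elim conjE, assumption)+
  have leg: "legal_placement A k q X prim T tuples"
    using part tup by (auto simp: legal_placement_def X_def)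
  \<comment> \<open>Words of length 1 suffice; \<open>w\<close> is compared with the all-zero
    assignment.\<close>
  define w :: "nat \<Rightarrow> bit vec"
    where "w = (\<lambda>x. if x = xa \<or> x = xb then vec 1 (\<lambda>_. 1) else 0\<^sub>v 1)"
  have rec: "permits_recovery A 1 X prim tuples {a, b}"
  proof -
    have "{a, b} \<subseteq> nodes A" "card {a, b} \<le> 2" using ab by simp_all
    thus ?thesis
      using univ[unfolded universally_recoverable_def, rule_format, OF finX _ leg] by simp
  qed
  have "parity 1 w t = parity 1 (\<lambda>_. 0\<^sub>v 1) t" if j: "j \<in> nodes A - {a, b}" and t: "t \<in> tuples j" for j t
    unfolding w_def
  proof (rule parity_flip_pair)
    show "finite t" using tup(1)[OF _ t] j k_ge by (intro card_ge_0_finite) auto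
    show "xa \<noteq> xb" by (fact special)
    have "xa \<in> received X T j \<longleftrightarrow> xb \<in> received X T j"
      using S(5) j special by (auto simp: received_def)
    moreover have "t \<subseteq> received X T j"
      using partition_onD1[OF part] j t by auto
    ultimately show "xa \<in> t \<longleftrightarrow> xb \<in> t" using together[OF _ t] j by auto
  qed
  moreover have "w \<in> X \<rightarrow> carrier_vec 1" "(\<lambda>_. 0\<^sub>v 1) \<in> X \<rightarrow> carrier_vec 1"
    by (auto simp: w_def)
  moreover have "\<forall>x\<in>X. prim x \<notin> {a, b} \<longrightarrow> w x = 0\<^sub>v 1"
    using special by (auto simp: w_def)
  ultimately have "\<forall>x\<in>X. prim x \<in> {a, b} \<longrightarrow> w x = 0\<^sub>v 1"
    using rec unfolding permits_recovery_def by blast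
  hence "w xa = 0\<^sub>v 1" using special by auto
  hence "vec 1 (\<lambda>_. 1 :: bit) $ 0 = 0\<^sub>v 1 $ 0" by (simp add: w_def)
  thus False by simp
qed

text \<open>Objects of two different nodes can use the very same target set, chosen among the
  \<open>l\<close> common targets.\<close>

lemma not_universally_recoverable_le:
  assumes "q \<le> l"
  shows "\<not> universally_recoverable A k 2 q"
proof -
  obtain U where "U \<subseteq> nodes A" "card U = 2"
    using obtain_subset_with_card_n[of 2 "nodes A"] k_ge k_less by auto
  then obtain a b where ab: "a \<in> nodes A" "b \<in> nodes A" "a \<noteq> b"
    by (auto simp: card_2_iff)
  have "q \<le> card (targets A a \<inter> targets A b)"
    using card_common[OF ab] assms by simp
  then obtain S where "S \<subseteq> targets A a \<inter> targets A b" "card S = q"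
    by (rule obtain_subset_with_card_n)
  thus ?thesis
    by (intro not_universally_recoverable_pair[OF ab, of S S]) simp_all
qed

text \<open>Beyond the common targets, each object sends its extra replica to the other failed node,
  where the parity is lost.\<close>

lemma not_universally_recoverable_reciprocal:
  assumes "reciprocal_pair A a b"
  shows "\<not> universally_recoverable A k 2 (l + 1)"
proof -
  let ?C = "targets A a \<inter> targets A b"
  have ab: "a \<in> nodes A" "b \<in> nodes A" "a \<noteq> b" "b \<in> targets A a" "a \<in> targets A b"
    using assms by (auto simp: reciprocal_pair_def)
  have "a \<notin> ?C" "b \<notin> ?C" using not_self_target by auto
  thus ?thesis
    using ab card_common[OF ab(1-3)]
    by (intro not_universally_recoverable_pair[OF ab(1-3), of "insert b ?C" "insert a ?C"]) auto
qed

section \<open>The threshold, and transfer from the design\<close>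

text \<open>Values up to \<open>l\<close> always fail, and \<open>l + 1\<close> fails given a
  reciprocal pair; \<open>k_ge\<close> keeps the claimed value within \<open>{0..k}\<close>.\<close>

lemma replica_threshold_2:
  "replica_threshold A k 2 = (if \<exists>i j. reciprocal_pair A i j then l + 2 else l + 1)"
  unfolding replica_threshold_def
proof (rule Least_equality)
  let ?q = "if \<exists>i j. reciprocal_pair A i j then l + 2 else l + 1"
  show "?q \<in> {0..k} \<and> universally_recoverable A k 2 ?q"
    using universally_recoverable_upper[of ?q] k_ge by auto
  fix q assume "q \<in> {0..k} \<and> universally_recoverable A k 2 q"
  hence u: "universally_recoverable A k 2 q" by simp
  hence "l + 1 \<le> q" using not_universally_recoverable_le[of q] by force
  moreover have "q \<noteq> l + 1" if "reciprocal_pair A i j" for i j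
    using not_universally_recoverable_reciprocal[OF that] u by auto
  ultimately show "?q \<le> q" by (auto simp: le_less)
qed

end

lemma card_Collect_bij_betw:
  assumes "bij_betw f S S'"
  shows "card {x \<in> S. Q (f x)} = card {y \<in> S'. Q y}"
proof (rule bij_betw_same_card)
  show "bij_betw f {x \<in> S. Q (f x)} {y \<in> S'. Q y}"
    using assms by (auto simp: bij_betw_def inj_on_def)
qed

text \<open>Rows are points and columns are blocks: \<open>bl\<close> transports the target and pair
  counts, \<open>pt\<close> the source counts.\<close>

lemma zero_diagonal_design_representative:
  assumes D: "sbibd P B inc v k l" and rep: "representative A P B inc v"
    and diag: "zero_diagonal A" and k: "l + 2 \<le> k"
  shows "zero_diagonal_design A k l"
proof -
  obtain pt bl where pt: "bij_betw pt {0..<v} P" and bl: "bij_betw bl {0..<v} B"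
    and A: "A = mat v v (\<lambda>(i, j). if inc (pt i) (bl j) then 1 else 0)"
    using rep by (auto simp: representative_def)
  have nodes: "nodes A = {0..<v}" by (simp add: nodes_def A)
  have tgt: "targets A i = {j \<in> {0..<v}. inc (pt i) (bl j)}" if "i \<in> {0..<v}" for i
    using that unfolding targets_def nodes by (auto simp: A split: if_splits)
  have src: "sources A j = {i \<in> {0..<v}. inc (pt i) (bl j)}" if "j \<in> {0..<v}" for j
    using that unfolding sources_def nodes by (auto simp: A split: if_splits)
  show ?thesis
  proof
    fix i assume i: "i \<in> nodes A"
    show "card (targets A i) = k"
      using card_Collect_bij_betw[OF bl, of "inc (pt i)"] D tgt i bij_betwE[OF pt]
      by (auto simp: nodes sbibd_def)
    show "card (sources A i) = k"
      using card_Collect_bij_betw[OF pt, of "\<lambda>p. inc p (bl i)"] D src i bij_betwE[OF bl]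
      by (auto simp: nodes sbibd_def)
    fix j assume j: "j \<in> nodes A" "i \<noteq> j"
    have "pt i \<noteq> pt j" "pt i \<in> P" "pt j \<in> P"
      using pt i j by (auto simp: nodes bij_betw_def inj_on_def)
    hence "card {b \<in> B. inc (pt i) b \<and> inc (pt j) b} = l"
      using D by (auto simp: sbibd_def)
    moreover have "targets A i \<inter> targets A j =
        {m \<in> {0..<v}. inc (pt i) (bl m) \<and> inc (pt j) (bl m)}"
      using tgt i j by (auto simp: nodes)
    ultimately show "card (targets A i \<inter> targets A j) = l"
      using card_Collect_bij_betw[OF bl, of "\<lambda>b. inc (pt i) b \<and> inc (pt j) b"] by simp
  qed (use D diag k in \<open>auto simp: sbibd_def nodes\<close>)
qed

theorem mainTheorem3:
  fixes P :: "'p set" and B :: "'b set" and inc :: "'p \<Rightarrow> 'b \<Rightarrow> bool"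
    and A :: "nat mat" and v k l :: nat
  assumes "sbibd P B inc v k l"
    and "representative A P B inc v"
    and "zero_diagonal A"
    and "k \<ge> l + 2"
  shows "replica_threshold A k 2 =
    (if \<exists>i j. reciprocal_pair A i j then l + 2 else l + 1)"
  by (rule zero_diagonal_design.replica_threshold_2[OF zero_diagonal_design_representative[OF assms]])

end
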